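(* Let $\mathbb{A}$ be a unital $C^*$-algebra, let $(X,\mathbb{A},p)$ be a complete $C^*$-algebra valued partial metric space, and let $T:X\to X$ be a mapping for which there is a real number $k\in(0,\tfrac12)$ such that $$p(Tx,Ty)\preceq k\,[p(x,Ty)+p(y,Tx)]\quad\text{for all }x,y\in X.$$ Then $T$ has a unique fixed point $u\in X$, and $p(u,u)=\theta$.
   Context: $\mathbb{A}$ is a unital $C^*$-algebra with unit $I$ and zero element $\theta$; $\mathbb{A}_+$ is the set of positive elements, and for self-adjoint $a,b$, $a\preceq b$ means $b-a\in\mathbb{A}_+$. A $C^*$-algebra valued partial metric space $(X,\mathbb{A},p)$ is a non-empty set $X$ with $p:X\times X\to\mathbb{A}$ such that for all $x,y,z\in X$: (i) $\theta\preceq p(x,y)$, and $p(x,x)=p(y,y)=p(x,y)$ iff $x=y$; (ii) $p(x,y)=p(y,x)$; (iii) $p(x,x)\preceq p(x,y)$; (iv) $p(x,y)\preceq p(x,z)+p(z,y)-p(z,z)$. A sequence $(x_n)$ converges to $x$ if $\lim_n (p(x_n,x)-p(x,x))=\theta$ in norm. It is partial Cauchy if for every $\varepsilon>0$ there is $N$ such that for all $n,m>N$, $q_{n,m}q_{n,m}^*\preceq\varepsilon^2 I$, where $q_{n,m}=p(x_n,x_m)-\frac12p(x_n,x_n)-\frac12p(x_m,x_m)$. The space is complete if every partial Cauchy sequence $(x_n)$ converges to a point $x\in X$ such that $\lim_n\bigl(p(x_n,x)-\frac12p(x_n,x_n)-\frac12p(x,x)\bigr)=\theta$. *)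

theory Defs
  imports Complex_Main "HOL-Library.Nonpos_Ints"
begin

text \<open>
  Unital \<open>C\<^sup>*\<close>-algebras. The superclasses supply the real Banach algebra with unit
  (so \<open>0 \<noteq> 1\<close> and \<open>norm 1 = 1\<close>); the class adds a complex scalar multiplication
  that extends the real one, and the involution.
\<close>

class cstar_algebra_1 = real_normed_algebra_1 + banach +
  fixes scaleC :: "complex \<Rightarrow> 'a \<Rightarrow> 'a"  (infixr \<open>*\<^sub>C\<close> 75)
    and cstar :: "'a \<Rightarrow> 'a"
  assumes scaleC_of_real: "complex_of_real r *\<^sub>C a = r *\<^sub>R a"
    and scaleC_add_right: "c *\<^sub>C (a + b) = c *\<^sub>C a + c *\<^sub>C b"
    and scaleC_add_left: "(c + d) *\<^sub>C a = c *\<^sub>C a + d *\<^sub>C a"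
    and scaleC_scaleC: "c *\<^sub>C d *\<^sub>C a = (c * d) *\<^sub>C a"
    and mult_scaleC_left: "(c *\<^sub>C a) * b = c *\<^sub>C (a * b)"
    and mult_scaleC_right: "a * (c *\<^sub>C b) = c *\<^sub>C (a * b)"
    and norm_scaleC: "norm (c *\<^sub>C a) = cmod c * norm a"
    and cstar_cstar: "cstar (cstar a) = a"
    and cstar_add: "cstar (a + b) = cstar a + cstar b"
    and cstar_scaleC: "cstar (c *\<^sub>C a) = cnj c *\<^sub>C cstar a"
    and cstar_mult: "cstar (a * b) = cstar b * cstar a"
    and cstar_identity: "norm (cstar a * a) = (norm a)\<^sup>2"

definition selfadjoint :: "'a::cstar_algebra_1 \<Rightarrow> bool"
  where "selfadjoint a \<longleftrightarrow> cstar a = a"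

definition cstar_spectrum :: "'a::cstar_algebra_1 \<Rightarrow> complex set"
  where "cstar_spectrum a =
    {c. \<not> (\<exists>b. b * (a - c *\<^sub>C 1) = 1 \<and> (a - c *\<^sub>C 1) * b = 1)}"

definition cstar_positive :: "'a::cstar_algebra_1 set"
  where "cstar_positive = {a. selfadjoint a \<and> cstar_spectrum a \<subseteq> \<real>\<^sub>\<ge>\<^sub>0}"

definition cstar_le :: "'a::cstar_algebra_1 \<Rightarrow> 'a \<Rightarrow> bool"  (infix \<open>\<preceq>\<close> 50)
  where "a \<preceq> b \<longleftrightarrow> selfadjoint a \<and> selfadjoint b \<and> b - a \<in> cstar_positive"

text \<open>The underlying set \<open>X\<close> is an explicit carrier; nothing is assumed about \<open>p\<close> outside it.\<close>

locale cstar_partial_metric_space =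
  fixes X :: "'x set" and p :: "'x \<Rightarrow> 'x \<Rightarrow> 'a::cstar_algebra_1"
  assumes nonempty: "X \<noteq> {}"
    and nonneg: "\<lbrakk>x \<in> X; y \<in> X\<rbrakk> \<Longrightarrow> 0 \<preceq> p x y"
    and eq_iff: "\<lbrakk>x \<in> X; y \<in> X\<rbrakk> \<Longrightarrow> (p x x = p y y \<and> p y y = p x y) \<longleftrightarrow> x = y"
    and sym: "\<lbrakk>x \<in> X; y \<in> X\<rbrakk> \<Longrightarrow> p x y = p y x"
    and small_self: "\<lbrakk>x \<in> X; y \<in> X\<rbrakk> \<Longrightarrow> p x x \<preceq> p x y"
    and triangle: "\<lbrakk>x \<in> X; y \<in> X; z \<in> X\<rbrakk> \<Longrightarrow> p x y \<preceq> p x z + p z y - p z z"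

definition pm_converges :: "('x \<Rightarrow> 'x \<Rightarrow> 'a::cstar_algebra_1) \<Rightarrow> (nat \<Rightarrow> 'x) \<Rightarrow> 'x \<Rightarrow> bool"
  where "pm_converges p s x \<longleftrightarrow> (\<lambda>n. p (s n) x - p x x) \<longlonglongrightarrow> 0"

definition pm_gap :: "('x \<Rightarrow> 'x \<Rightarrow> 'a::cstar_algebra_1) \<Rightarrow> 'x \<Rightarrow> 'x \<Rightarrow> 'a"
  where "pm_gap p x y = p x y - (1/2) *\<^sub>R p x x - (1/2) *\<^sub>R p y y"

definition partial_Cauchy :: "('x \<Rightarrow> 'x \<Rightarrow> 'a::cstar_algebra_1) \<Rightarrow> (nat \<Rightarrow> 'x) \<Rightarrow> bool"
  where "partial_Cauchy p s \<longleftrightarrow>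
    (\<forall>\<epsilon>>0. \<exists>N. \<forall>n>N. \<forall>m>N.
       pm_gap p (s n) (s m) * cstar (pm_gap p (s n) (s m)) \<preceq> \<epsilon>\<^sup>2 *\<^sub>R 1)"

locale complete_cstar_partial_metric_space = cstar_partial_metric_space +
  assumes complete: "\<lbrakk>\<And>n. s n \<in> X; partial_Cauchy p s\<rbrakk> \<Longrightarrow>
    \<exists>x\<in>X. pm_converges p s x \<and> (\<lambda>n. pm_gap p (s n) x) \<longlonglongrightarrow> 0"

end

theory Submission
  imports Defs "HOL-Analysis.Complex_Analysis_Basics"
begin

text \<open>
  The norms \<open>N x y = \<parallel>p x y\<parallel>\<close> carry the argument. They are symmetric, satisfy the triangle
  inequality and \<open>N x x \<le> N x y\<close>, and the contraction condition passes to them. Along an orbit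
  \<open>s (Suc n) = T (s n)\<close> the condition at \<open>s n\<close> and \<open>s (Suc n)\<close> involves
  \<open>p (s n) (s (Suc (Suc n)))\<close> and the self-distance of \<open>s (Suc n)\<close>; the triangle inequality of the
  partial metric absorbs both, so that consecutive distances shrink by the factor
  \<open>k / (1 - k) < 1\<close>. The orbit is then Cauchy with self-distances tending to \<open>0\<close>, and completeness
  yields a limit \<open>u\<close> with \<open>p u u = 0\<close> (\<open>limit_of_geometric_steps\<close>). Applying the condition to \<open>u\<close>
  and \<open>s n\<close> gives \<open>(1 - k) N u (T u) \<le> 0\<close> in the limit, hence \<open>T u = u\<close>. For fixed points \<open>v\<close>, \<open>w\<close>
  the condition reads \<open>N v w \<le> 2 k N v w\<close>, so \<open>p v w = 0\<close>, which gives both uniqueness and the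
  vanishing self-distance.

  The passage to norms rests on two facts about the order of a \<open>C\<^sup>*\<close>-algebra: it is transitive,
  because sums of positive elements are positive (\<open>cstar_positive_add\<close>), and \<open>0 \<preceq> a \<preceq> b\<close> implies
  \<open>\<parallel>a\<parallel> \<le> \<parallel>b\<parallel>\<close> (\<open>cstar_norm_mono\<close>). Since positivity is a condition on the spectrum, both need a
  translation between spectrum and norm. It has three ingredients: the Neumann series bounds the
  spectrum by the norm; self-adjoint elements have real spectrum
  (\<open>selfadjoint_spectrum_real\<close>, by an argument of Arens); and their norm is at most any bound on
  the moduli of their spectrum (\<open>selfadjoint_norm_le_spectral_bound\<close>). The proof of the last one
  follows Rickart's proof of the spectral radius formula and averages the resolvent over roots of
  unity.
\<close>

section \<open>Algebra of the involution and of the scalars\<close>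

interpretation scaleC: vector_space "scaleC :: complex \<Rightarrow> 'a::cstar_algebra_1 \<Rightarrow> 'a"
proof
  show "1 *\<^sub>C a = a" for a :: 'a
    using scaleC_of_real[of 1 a] by simp
qed (auto simp: scaleC_add_right scaleC_add_left scaleC_scaleC)

lemma cstar_one: "cstar (1::'a::cstar_algebra_1) = 1"
proof -
  have "cstar (1 * cstar (1::'a)) = cstar (cstar 1) * cstar 1"
    by (rule cstar_mult)
  then show ?thesis by (simp add: cstar_cstar)
qed

lemma cstar_scaleR: "cstar (r *\<^sub>R a) = r *\<^sub>R cstar (a::'a::cstar_algebra_1)"
  using cstar_scaleC[of "complex_of_real r" a] by (simp add: scaleC_of_real)

lemma cstar_minus: "cstar (- a) = - cstar (a::'a::cstar_algebra_1)"
  using cstar_scaleR[of "-1" a] by simp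

lemma cstar_diff: "cstar (a - b) = cstar a - cstar (b::'a::cstar_algebra_1)"
  using cstar_add[of a "- b"] by (simp add: cstar_minus)

lemma norm_cstar: "norm (cstar a) = norm (a::'a::cstar_algebra_1)"
proof -
  have le: "norm b \<le> norm (cstar b)" for b :: 'a
  proof (cases "b = 0")
    case False
    have "norm b * norm b \<le> norm (cstar b) * norm b"
      using norm_mult_ineq[of "cstar b" b] by (simp add: cstar_identity power2_eq_square)
    with False show ?thesis by simp
  qed simp
  show ?thesis using le[of a] le[of "cstar a"] by (simp add: cstar_cstar)
qed

lemma selfadjoint_one: "selfadjoint (1::'a::cstar_algebra_1)"
  and selfadjoint_add: "selfadjoint a \<Longrightarrow> selfadjoint b \<Longrightarrow> selfadjoint (a + b)"
  and selfadjoint_diff: "selfadjoint a \<Longrightarrow> selfadjoint b \<Longrightarrow> selfadjoint (a - b)"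
  and selfadjoint_scaleR: "selfadjoint a \<Longrightarrow> selfadjoint (r *\<^sub>R a)"
  and selfadjoint_square: "selfadjoint a \<Longrightarrow> selfadjoint (a * a)"
  and selfadjoint_mult_cstar: "selfadjoint (c * cstar c)"
  for a b c :: "'a::cstar_algebra_1"
  by (simp_all add: selfadjoint_def cstar_one cstar_add cstar_diff cstar_scaleR cstar_mult
      cstar_cstar)

lemmas selfadjoint_intros = selfadjoint_one selfadjoint_add selfadjoint_diff selfadjoint_scaleR
  selfadjoint_square selfadjoint_mult_cstar

section \<open>Invertible elements and the spectrum\<close>

definition inverse_pair :: "'a::monoid_mult \<Rightarrow> 'a \<Rightarrow> bool"
  where "inverse_pair a b \<longleftrightarrow> a * b = 1 \<and> b * a = 1"

lemma cstar_spectrum_iff: "c \<in> cstar_spectrum a \<longleftrightarrow> (\<nexists>b. inverse_pair (a - c *\<^sub>C 1) b)"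
  by (auto simp: cstar_spectrum_def inverse_pair_def)

lemma inverse_pair_scaleC:
  fixes a b :: "'a::cstar_algebra_1"
  assumes "inverse_pair a b" and "c \<noteq> 0"
  shows "inverse_pair (c *\<^sub>C a) (inverse c *\<^sub>C b)"
  using assms by (simp add: inverse_pair_def mult_scaleC_left mult_scaleC_right)

lemma neumann_inverse:
  fixes x :: "'a::{real_normed_algebra_1,banach}"
  assumes "norm x < 1"
  shows "inverse_pair (1 - x) (\<Sum>n. x ^ n)"
proof -
  have S: "summable (\<lambda>n. x ^ n)"
    using assms by (rule complete_algebra_summable_geometric)
  have "(\<lambda>n. x ^ n - x ^ Suc n) sums (x ^ 0 - 0)"
    by (rule telescope_sums') (rule LIMSEQ_power_zero[OF assms])
  then have sum1: "(\<Sum>n. x ^ n - x ^ Suc n) = 1"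
    by (simp add: sums_iff)
  have "(1 - x) * (\<Sum>n. x ^ n) = (\<Sum>n. (1 - x) * x ^ n)"
    using suminf_mult[OF S] by simp
  moreover have "(\<Sum>n. x ^ n) * (1 - x) = (\<Sum>n. x ^ n * (1 - x))"
    using suminf_mult2[OF S] by simp
  ultimately show ?thesis
    using sum1 by (simp add: inverse_pair_def algebra_simps power_commutes)
qed

lemma spectrum_norm_le:
  fixes a :: "'a::cstar_algebra_1"
  assumes "c \<in> cstar_spectrum a"
  shows "cmod c \<le> norm a"
proof (rule ccontr)
  assume "\<not> cmod c \<le> norm a"
  then have less: "norm a < cmod c" by simp
  then have c: "c \<noteq> 0" by auto
  have "norm (inverse c *\<^sub>C a) < 1"
    using less c by (simp add: norm_scaleC norm_inverse norm_divide divide_simps)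
  then obtain b where "inverse_pair (1 - inverse c *\<^sub>C a) b"
    using neumann_inverse by blast
  then have "inverse_pair ((- c) *\<^sub>C (1 - inverse c *\<^sub>C a)) (inverse (- c) *\<^sub>C b)"
    by (rule inverse_pair_scaleC) (use c in simp)
  moreover have "(- c) *\<^sub>C (1 - inverse c *\<^sub>C a) = a - c *\<^sub>C 1"
    using c by (simp add: scaleC.scale_right_diff_distrib)
  ultimately show False
    using assms by (auto simp: cstar_spectrum_iff)
qed

lemma spectrum_shift:
  fixes a :: "'a::cstar_algebra_1"
  shows "c \<in> cstar_spectrum (a + d *\<^sub>C 1) \<longleftrightarrow> c - d \<in> cstar_spectrum a"
proof -
  have "a + d *\<^sub>C 1 - c *\<^sub>C 1 = a - (c - d) *\<^sub>C 1"
    by (simp add: scaleC.scale_left_diff_distrib)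
  then show ?thesis by (simp only: cstar_spectrum_iff)
qed

lemma spectrum_reflect:
  fixes a :: "'a::cstar_algebra_1"
  shows "c \<in> cstar_spectrum (t *\<^sub>R 1 - a) \<longleftrightarrow> complex_of_real t - c \<in> cstar_spectrum a"
proof -
  have "t *\<^sub>R 1 - a - c *\<^sub>C 1 = - (a - (complex_of_real t - c) *\<^sub>C 1)"
    by (simp add: scaleC.scale_left_diff_distrib scaleC_of_real)
  moreover have "(\<exists>b. inverse_pair (- x) b) \<longleftrightarrow> (\<exists>b. inverse_pair x b)" for x :: 'a
    unfolding inverse_pair_def by (metis minus_mult_minus minus_minus)
  ultimately show ?thesis by (simp only: cstar_spectrum_iff)
qed

text \<open>
  Translation by \<open>\<i> t\<close> moves the spectrum of \<open>a\<close> by \<open>t\<close> in the imaginary direction, but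
  the \<open>C\<^sup>*\<close>-identity bounds the norm of the translate by \<open>sqrt (\<parallel>a\<parallel>\<^sup>2 + t\<^sup>2)\<close>. A point with
  imaginary part \<open>y \<noteq> 0\<close> would leave the ball of that radius for \<open>t\<close> large of the same sign as \<open>y\<close>.
\<close>

lemma selfadjoint_spectrum_real:
  fixes a :: "'a::cstar_algebra_1"
  assumes sa: "selfadjoint a" and c: "c \<in> cstar_spectrum a"
  shows "Im c = 0"
proof (rule ccontr)
  assume nz: "Im c \<noteq> 0"
  have bound: "2 * Im c * t \<le> (norm a)\<^sup>2" for t :: real
  proof -
    define d where "d = \<i> * complex_of_real t"
    have cd: "cnj d = - d" "d * d = complex_of_real (- t\<^sup>2)"
      by (auto simp: d_def complex_eq_iff power2_eq_square)
    have "c + d \<in> cstar_spectrum (a + d *\<^sub>C 1)"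
      using c by (simp add: spectrum_shift)
    then have "cmod (c + d) \<le> norm (a + d *\<^sub>C 1)"
      by (rule spectrum_norm_le)
    then have "(cmod (c + d))\<^sup>2 \<le> (norm (a + d *\<^sub>C 1))\<^sup>2"
      by (simp add: power_mono)
    also have "\<dots> = norm ((a - d *\<^sub>C 1) * (a + d *\<^sub>C 1))"
      using sa by (simp add: cstar_identity[symmetric] cstar_add cstar_scaleC cstar_one cd
          selfadjoint_def)
    also have "(a - d *\<^sub>C 1) * (a + d *\<^sub>C 1) = a * a - (d * d) *\<^sub>C 1"
      by (simp add: algebra_simps mult_scaleC_left mult_scaleC_right)
    also have "\<dots> = a * a + t\<^sup>2 *\<^sub>R 1"
      unfolding cd(2) scaleC_of_real by simp
    also have "norm \<dots> \<le> norm a * norm a + t\<^sup>2"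
      by (rule norm_triangle_le) (simp add: norm_mult_ineq)
    finally have "(Re c)\<^sup>2 + (Im c + t)\<^sup>2 \<le> (norm a)\<^sup>2 + t\<^sup>2"
      unfolding cmod_power2 power2_eq_square[of "norm a"] by (simp add: d_def)
    then have "(Re c)\<^sup>2 + (Im c)\<^sup>2 + 2 * Im c * t \<le> (norm a)\<^sup>2"
      by (simp add: power2_sum)
    then show ?thesis
      by (smt (verit) zero_le_power2)
  qed
  show False
    using bound[of "((norm a)\<^sup>2 + 1) / (2 * Im c)"] nz by simp
qed

section \<open>The norm of a self-adjoint element is its spectral radius\<close>

text \<open>
  The resolvent identity \<open>R z - R w = R z ((z - w) b) R w\<close> bounds \<open>R\<close> near each point
  and so makes it continuous; compactness of the disk does the rest.
\<close>

lemma resolvent_bounded: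
  fixes b :: "'a::cstar_algebra_1"
  assumes R: "\<And>z. cmod z \<le> 1 \<Longrightarrow> inverse_pair (1 - z *\<^sub>C b) (R z)"
  obtains M where "\<And>z. cmod z \<le> 1 \<Longrightarrow> norm (R z) \<le> M"
    and "\<And>z w. cmod z \<le> 1 \<Longrightarrow> cmod w \<le> 1 \<Longrightarrow> norm (R z - R w) \<le> M * M * norm b * cmod (z - w)"
proof -
  have diff: "norm (R z - R w) \<le> norm (R z) * norm (R w) * norm b * cmod (z - w)"
    if "cmod z \<le> 1" "cmod w \<le> 1" for z w
  proof -
    have "R z * ((1 - w *\<^sub>C b) - (1 - z *\<^sub>C b)) * R w =
        R z * ((1 - w *\<^sub>C b) * R w) - (R z * (1 - z *\<^sub>C b)) * R w"
      by (simp add: algebra_simps)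
    then have "R z * ((1 - w *\<^sub>C b) - (1 - z *\<^sub>C b)) * R w = R z - R w"
      using R[OF that(1)] R[OF that(2)] unfolding inverse_pair_def by simp
    also have "(1 - w *\<^sub>C b) - (1 - z *\<^sub>C b) = (z - w) *\<^sub>C b"
      by (simp add: scaleC.scale_left_diff_distrib)
    finally have "norm (R z - R w) = norm (R z * ((z - w) *\<^sub>C b) * R w)" by simp
    also have "\<dots> \<le> norm (R z) * norm ((z - w) *\<^sub>C b) * norm (R w)"
      by (meson norm_mult_ineq mult_right_mono norm_ge_zero order_trans)
    finally show ?thesis by (simp add: norm_scaleC mult_ac)
  qed
  have "continuous_on (cball 0 1) R"
    unfolding continuous_on_iff
  proof (intro ballI allI impI)
    fix z :: complex and e :: real
    assume z: "z \<in> cball 0 1" and e: "0 < e"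
    define K where "K = norm (R z) * norm b"
    define L where "L = 2 * norm (R z) * norm (R z) * norm b"
    define \<delta> where "\<delta> = min (1 / (2 * (K + 1))) (e / (L + 1))"
    have K: "K \<ge> 0" and L: "L \<ge> 0" by (simp_all add: K_def L_def)
    have \<delta>: "\<delta> > 0" using K L e by (simp add: \<delta>_def)
    show "\<exists>d>0. \<forall>w\<in>cball 0 1. dist w z < d \<longrightarrow> dist (R w) (R z) < e"
    proof (intro exI[of _ \<delta>] conjI \<delta> ballI impI)
      fix w assume w: "w \<in> cball (0::complex) 1" and d: "dist w z < \<delta>"
      have d1: "cmod (w - z) \<le> 1 / (2 * (K + 1))" and d2: "cmod (w - z) < e / (L + 1)"
        using d by (auto simp: \<delta>_def dist_norm)
      have D: "norm (R w - R z) \<le> norm (R w) * (K * cmod (w - z))"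
        using diff[of w z] w z by (simp add: K_def mult_ac)
      have "K * cmod (w - z) \<le> K * (1 / (2 * (K + 1)))"
        using d1 K by (rule mult_left_mono)
      also have "\<dots> \<le> 1 / 2" using K by (simp add: field_simps)
      finally have "norm (R w) * (K * cmod (w - z)) \<le> norm (R w) * (1/2)"
        by (rule mult_left_mono) simp
      with D have "norm (R w) \<le> 2 * norm (R z)"
        using norm_triangle_ineq2[of "R w" "R z"] by simp
      then have "norm (R w) * (K * cmod (w - z)) \<le> 2 * norm (R z) * (K * cmod (w - z))"
        by (rule mult_right_mono) (simp add: K)
      also have "\<dots> = L * cmod (w - z)" by (simp add: K_def L_def)
      also have "\<dots> \<le> (L + 1) * cmod (w - z)" by (simp add: mult_right_mono)
      also have "\<dots> < e" using d2 L by (simp add: field_simps)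
      finally show "dist (R w) (R z) < e" using D by (simp add: dist_norm)
    qed
  qed
  then have "compact (R ` cball 0 1)"
    by (rule compact_continuous_image) simp
  then obtain M where "\<forall>x\<in>R ` cball 0 1. norm x \<le> M"
    using compact_imp_bounded bounded_iff by blast
  then have M: "norm (R z) \<le> M" if "cmod z \<le> 1" for z
    using that by simp
  have "norm (R z - R w) \<le> M * M * norm b * cmod (z - w)" if "cmod z \<le> 1" "cmod w \<le> 1" for z w
  proof -
    have "norm (R z) * norm (R w) \<le> M * M"
      using M[OF that(1)] M[OF that(2)]
      by (meson mult_mono norm_ge_zero order_trans)
    then have "norm (R z) * norm (R w) * norm b * cmod (z - w) \<le> M * M * norm b * cmod (z - w)"
      by (intro mult_right_mono) auto
    with diff[OF that] show ?thesis by linarith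
  qed
  with M show ?thesis by (rule that)
qed

text \<open>
  The partial fractions \<open>2 / (1 - x\<^sup>2) = 1 / (1 - x) + 1 / (1 + x)\<close>: an average of two resolvent
  values is a resolvent value of the square.
\<close>

lemma inverse_pair_square:
  fixes x :: "'a::real_algebra_1"
  assumes U: "inverse_pair (1 - x) U" and V: "inverse_pair (1 + x) V"
  shows "inverse_pair (1 - x * x) ((1/2) *\<^sub>R (U + V))"
proof -
  have f: "1 - x * x = (1 - x) * (1 + x)" "1 - x * x = (1 + x) * (1 - x)"
    by (simp_all add: algebra_simps)
  have "(1 - x * x) * (U + V) = (1 + x) * ((1 - x) * U) + (1 - x) * ((1 + x) * V)"
    unfolding distrib_left by (simp only: f(2)[of] mult.assoc[symmetric])
      (simp add: f[symmetric])
  also have "\<dots> = 2" using U V by (simp add: inverse_pair_def)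
  finally have 1: "(1 - x * x) * (U + V) = 2" .
  have "(U + V) * (1 - x * x) = (U * (1 - x)) * (1 + x) + (V * (1 + x)) * (1 - x)"
    unfolding distrib_right by (simp only: mult.assoc f[symmetric])
  also have "\<dots> = 2" using U V by (simp add: inverse_pair_def)
  finally have 2: "(U + V) * (1 - x * x) = 2" .
  have "(1/2) *\<^sub>R (2::'a) = 1" by (metis scaleR_half_double one_add_one)
  with 1 2 show ?thesis by (simp add: inverse_pair_def)
qed

text \<open>
  If \<open>R\<close> inverts \<open>1 - z b\<close> on the closed disk, the average of \<open>R\<close> over the points \<open>v\<close> with
  \<open>v\<^sup>n = 1\<close> inverts \<open>1 - b\<^sup>n\<close>; for \<open>n = 2\<^sup>m\<close> the average is built by halving steps. Averaging
  does not increase distances, so \<open>(1 - b\<^sup>n)\<^sup>-\<^sup>1\<close> stays uniformly close to \<open>(1 - \<rho>\<^sup>n b\<^sup>n)\<^sup>-\<^sup>1\<close>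
  for \<open>\<rho> < 1\<close> near \<open>1\<close>. With growing \<open>n\<close> the latter tends to \<open>1\<close>, hence \<open>b\<^sup>n\<close> has to become small.
\<close>

lemma iterated_square_norm_less_one:
  fixes b :: "'a::cstar_algebra_1"
  assumes inv: "\<And>z. cmod z \<le> 1 \<Longrightarrow> \<exists>c. inverse_pair (1 - z *\<^sub>C b) c"
    and b: "norm b \<le> 1"
  shows "\<exists>m. norm (b ^ 2 ^ m) < 1"
proof -
  obtain R where R: "\<And>z. cmod z \<le> 1 \<Longrightarrow> inverse_pair (1 - z *\<^sub>C b) (R z)"
    using inv by metis
  obtain M where lip: "\<And>z w. cmod z \<le> 1 \<Longrightarrow> cmod w \<le> 1 \<Longrightarrow>
      norm (R z - R w) \<le> M * M * norm b * cmod (z - w)"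
    using resolvent_bounded[OF R] by metis
  \<comment> \<open>The radius \<open>\<rho>\<close> keeps the two inverses \<open>U\<close>, \<open>V\<close> below within \<open>1/8\<close> of each other. Since
    \<open>\<parallel>x\<parallel> \<le> 1/9\<close> puts \<open>V\<close> within \<open>1/8\<close> of \<open>1\<close>, this leaves \<open>\<parallel>U - 1\<parallel> \<le> 1/4\<close> and \<open>\<parallel>c\<parallel> \<le> 1/2\<close>.\<close>
  define K where "K = M * M + 1"
  have K: "M * M = K - 1" "1 \<le> K" by (simp_all add: K_def)
  define \<rho> where "\<rho> = 1 - 1 / (8 * K)"
  have \<rho>: "0 \<le> \<rho>" "\<rho> < 1" and M\<rho>: "M * M * (1 - \<rho>) \<le> 1/8"
    unfolding K(1) using K(2) by (simp_all add: \<rho>_def divide_simps)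
  have avg: "\<exists>U V. inverse_pair (1 - w *\<^sub>C b ^ 2 ^ m) U \<and>
      inverse_pair (1 - (complex_of_real (\<rho> ^ 2 ^ m) * w) *\<^sub>C b ^ 2 ^ m) V \<and>
      norm (U - V) \<le> 1/8" if "cmod w = 1" for w m
    using that
  proof (induction m arbitrary: w)
    case 0
    have \<rho>w: "cmod (complex_of_real \<rho> * w) \<le> 1"
      using \<rho> 0 by (simp add: norm_mult)
    have "w - complex_of_real \<rho> * w = complex_of_real (1 - \<rho>) * w"
      by (simp add: algebra_simps)
    then have "cmod (w - complex_of_real \<rho> * w) = 1 - \<rho>"
      using \<rho> 0 by (simp add: norm_mult del: of_real_diff)
    then have "norm (R w - R (complex_of_real \<rho> * w)) \<le> M * M * norm b * (1 - \<rho>)"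
      using lip[of w "complex_of_real \<rho> * w"] \<rho>w 0 by simp
    also have "\<dots> \<le> M * M * 1 * (1 - \<rho>)"
      using b \<rho> by (intro mult_right_mono mult_left_mono) auto
    finally have "norm (R w - R (complex_of_real \<rho> * w)) \<le> 1/8"
      using M\<rho> by simp
    then show ?case
      using R[of w] R[OF \<rho>w] 0 by auto
  next
    case (Suc m)
    define v where "v = csqrt w"
    define c where "c = b ^ 2 ^ m"
    define q where "q = complex_of_real (\<rho> ^ 2 ^ m)"
    have v: "v * v = w" by (simp add: v_def flip: power2_eq_square)
    have "cmod v * cmod v = 1" using Suc.prems by (simp add: v flip: norm_mult)
    then have "cmod v = 1"
      using norm_ge_zero[of v] by (auto simp: square_eq_1_iff)
    then have nv: "cmod v = 1" "cmod (- v) = 1" by simp_all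
    obtain U V U' V' where UV: "inverse_pair (1 - v *\<^sub>C c) U"
        "inverse_pair (1 - (q * v) *\<^sub>C c) V" "norm (U - V) \<le> 1/8"
        "inverse_pair (1 - (- v) *\<^sub>C c) U'"
        "inverse_pair (1 - (q * - v) *\<^sub>C c) V'" "norm (U' - V') \<le> 1/8"
      using Suc.IH[OF nv(1)] Suc.IH[OF nv(2)] unfolding c_def q_def by blast
    have c2: "b ^ 2 ^ Suc m = c * c"
      by (simp add: c_def mult_2 flip: power_add)
    have q2: "complex_of_real (\<rho> ^ 2 ^ Suc m) = q * q"
      by (simp add: q_def mult_2 power_add)
    have "(v *\<^sub>C c) * (v *\<^sub>C c) = w *\<^sub>C (c * c)"
      by (simp add: mult_scaleC_left mult_scaleC_right v)
    then have 1: "inverse_pair (1 - w *\<^sub>C (c * c)) ((1/2) *\<^sub>R (U + U'))"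
      using inverse_pair_square[of "v *\<^sub>C c" U U'] UV by simp
    have "((q * v) *\<^sub>C c) * ((q * v) *\<^sub>C c) = (q * q * w) *\<^sub>C (c * c)"
      by (simp add: mult_scaleC_left mult_scaleC_right mult_ac flip: v)
    then have 2: "inverse_pair (1 - (q * q * w) *\<^sub>C (c * c)) ((1/2) *\<^sub>R (V + V'))"
      using inverse_pair_square[of "(q * v) *\<^sub>C c" V V'] UV by simp
    have "(1/2) *\<^sub>R (U + U') - (1/2) *\<^sub>R (V + V') = (1/2) *\<^sub>R ((U - V) + (U' - V'))"
      by (simp add: algebra_simps)
    then have "norm ((1/2) *\<^sub>R (U + U') - (1/2) *\<^sub>R (V + V')) = (1/2) * norm ((U - V) + (U' - V'))"
      by simp
    also have "\<dots> \<le> (1/2) * (norm (U - V) + norm (U' - V'))"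
      by (intro mult_left_mono norm_triangle_ineq) simp
    finally have 3: "norm ((1/2) *\<^sub>R (U + U') - (1/2) *\<^sub>R (V + V')) \<le> 1/8"
      using UV by simp
    show ?case
      unfolding c2 q2 using 1 2 3 by blast
  qed
  have "(\<lambda>n. \<rho> ^ n) \<longlonglongrightarrow> 0" using \<rho> by (intro LIMSEQ_realpow_zero) auto
  then obtain n0 where n0: "\<And>n. n \<ge> n0 \<Longrightarrow> \<rho> ^ n < 1/9"
    using order_tendstoD(2)[of _ 0 sequentially "1/9"] by (fastforce simp: eventually_sequentially)
  define m where "m = n0"
  define c where "c = b ^ 2 ^ m"
  define x where "x = (\<rho> ^ 2 ^ m) *\<^sub>R c"
  have "n0 \<le> 2 ^ m" by (simp add: m_def less_imp_le)
  then have \<rho>m: "\<rho> ^ 2 ^ m < 1/9" by (rule n0)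
  have nc: "norm c \<le> 1"
    using norm_power_ineq[of b "2 ^ m"] power_le_one[OF norm_ge_zero b, of "2 ^ m"]
    by (simp add: c_def)
  obtain U V where U: "inverse_pair (1 - c) U" and V: "inverse_pair (1 - x) V"
    and UV: "norm (U - V) \<le> 1/8"
    using avg[of 1 m] by (auto simp: c_def x_def scaleC_of_real simp del: of_real_power)
  have "\<rho> ^ 2 ^ m * norm c \<le> 1/9 * 1"
    using \<rho>m nc by (intro mult_mono) auto
  then have nx: "norm x \<le> 1/9" using \<rho> by (simp add: x_def)
  \<comment> \<open>The equations \<open>V - 1 = x V\<close> and \<open>U - 1 = c U\<close> lead from a small \<open>x\<close> to \<open>V\<close> near \<open>1\<close>, and
    from \<open>U\<close> near \<open>1\<close> to a small \<open>c\<close>.\<close>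
  have "x * V = V - (1 - x) * V" "(U - 1) - c * (U - 1) = (1 - c) * U - 1 + c"
    by (simp_all add: algebra_simps)
  then have Vx: "x * V = V - 1" and Uc: "(U - 1) - c * (U - 1) = c"
    using U V by (simp_all only: inverse_pair_def) simp_all
  have c: "norm c \<le> norm (U - 1) + norm c * norm (U - 1)"
    using norm_triangle_ineq4[of "U - 1" "c * (U - 1)"] norm_mult_ineq[of c "U - 1"]
    unfolding Uc by linarith
  have "norm (V - 1) \<le> norm x * norm V"
    using norm_mult_ineq[of x V] unfolding Vx .
  moreover have "norm V \<le> norm (V - 1) + 1"
    using norm_triangle_ineq[of "V - 1" 1] by simp
  moreover have "norm x * norm V \<le> 1/9 * norm V"
    using nx by (rule mult_right_mono) simp
  ultimately have V1: "norm (V - 1) \<le> 1/8" by linarith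
  have U1: "norm (U - 1) \<le> 1/4"
    using norm_triangle_ineq[of "U - V" "V - 1"] UV V1 by simp
  have "norm c * norm (U - 1) \<le> 1 * norm (U - 1)"
    using nc by (rule mult_right_mono) simp
  with U1 c have "norm c < 1" by linarith
  then show ?thesis unfolding c_def by blast
qed

lemma norm_selfadjoint_iterated_square:
  fixes b :: "'a::cstar_algebra_1"
  assumes "selfadjoint b"
  shows "norm (b ^ 2 ^ m) = norm b ^ 2 ^ m"
proof -
  have sq: "norm (x * x) = norm x * norm x" if "selfadjoint x" for x :: 'a
    using cstar_identity[of x] that by (simp add: selfadjoint_def power2_eq_square)
  have "selfadjoint (b ^ 2 ^ m) \<and> norm (b ^ 2 ^ m) = norm b ^ 2 ^ m"
    by (induction m) (use assms in \<open>simp_all add: mult_2 power_add sq selfadjoint_square\<close>)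
  then show ?thesis ..
qed

text \<open>
  If the norm exceeded the bound, \<open>b = a / \<parallel>a\<parallel>\<close> would have its spectrum strictly inside the unit
  disk, so that some \<open>b ^ 2 ^ m\<close> has norm below \<open>1\<close>; but the \<open>C\<^sup>*\<close>-identity keeps all these norms
  equal to \<open>1\<close>.
\<close>

lemma selfadjoint_norm_le_spectral_bound:
  fixes a :: "'a::cstar_algebra_1"
  assumes sa: "selfadjoint a" and s: "0 \<le> s"
    and spec: "\<And>c. c \<in> cstar_spectrum a \<Longrightarrow> cmod c \<le> s"
  shows "norm a \<le> s"
proof (rule ccontr)
  assume "\<not> norm a \<le> s"
  then have less: "s < norm a" by simp
  then have na: "norm a > 0" using s by linarith
  define b where "b = inverse (norm a) *\<^sub>R a"
  have nb: "norm b = 1" using na by (auto simp: b_def)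
  have "\<exists>c. inverse_pair (1 - z *\<^sub>C b) c" if z: "cmod z \<le> 1" for z
  proof (cases "z = 0")
    case False
    define d where "d = complex_of_real (norm a) / z"
    have d: "d \<noteq> 0" using False na by (auto simp: d_def)
    have "norm a \<le> cmod d"
      using z False na by (simp add: d_def norm_divide divide_simps mult_left_le)
    then have "d \<notin> cstar_spectrum a" using spec[of d] less by auto
    then obtain c where "inverse_pair (a - d *\<^sub>C 1) c" by (auto simp: cstar_spectrum_iff)
    then have "inverse_pair ((- inverse d) *\<^sub>C (a - d *\<^sub>C 1)) (inverse (- inverse d) *\<^sub>C c)"
      by (rule inverse_pair_scaleC) (use d in simp)
    moreover have "(- inverse d) *\<^sub>C (a - d *\<^sub>C 1) = 1 - inverse d *\<^sub>C a"
      using d by (simp add: scaleC.scale_right_diff_distrib)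
    moreover have "inverse d *\<^sub>C a = z *\<^sub>C b"
      by (simp add: b_def d_def field_simps flip: scaleC_of_real)
    ultimately show ?thesis by auto
  qed (auto simp: inverse_pair_def)
  then obtain m where "norm (b ^ 2 ^ m) < 1"
    using iterated_square_norm_less_one nb by fastforce
  moreover have "selfadjoint b"
    unfolding b_def using sa by (rule selfadjoint_scaleR)
  ultimately show False
    by (simp add: norm_selfadjoint_iterated_square nb)
qed

section \<open>The positive cone\<close>

text \<open>
  For self-adjoint \<open>a\<close> and \<open>t \<ge> \<parallel>a\<parallel>\<close>, positivity of \<open>a\<close> means \<open>\<parallel>t - a\<parallel> \<le> t\<close>. The next
  two lemmas are the two directions; they replace statements about the spectrum, which does not
  behave well under sums, by norm estimates, which do.
\<close>

lemma cstar_positive_if_norm_le: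
  fixes a :: "'a::cstar_algebra_1"
  assumes sa: "selfadjoint a" and t: "norm (t *\<^sub>R 1 - a) \<le> t"
  shows "a \<in> cstar_positive"
proof -
  have "c \<in> \<real>\<^sub>\<ge>\<^sub>0" if c: "c \<in> cstar_spectrum a" for c
  proof -
    have Im: "Im c = 0" using sa c by (rule selfadjoint_spectrum_real)
    have "complex_of_real t - c \<in> cstar_spectrum (t *\<^sub>R 1 - a)"
      using c by (simp add: spectrum_reflect)
    then have "cmod (complex_of_real t - c) \<le> t"
      using spectrum_norm_le t order_trans by blast
    then have "0 \<le> Re c"
      using abs_Re_le_cmod[of "complex_of_real t - c"] by simp
    with Im show ?thesis by (simp add: complex_nonneg_Reals_iff)
  qed
  with sa show ?thesis by (auto simp: cstar_positive_def)
qed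

lemma cstar_positive_norm_diff_le:
  fixes a :: "'a::cstar_algebra_1"
  assumes a: "a \<in> cstar_positive" and t: "norm a \<le> t"
  shows "norm (t *\<^sub>R 1 - a) \<le> t"
proof (rule selfadjoint_norm_le_spectral_bound)
  show "selfadjoint (t *\<^sub>R 1 - a)"
    using a by (simp add: cstar_positive_def selfadjoint_intros)
  show "0 \<le> t" using t norm_ge_zero order_trans by blast
  fix c assume "c \<in> cstar_spectrum (t *\<^sub>R 1 - a)"
  then have d: "complex_of_real t - c \<in> cstar_spectrum a" by (simp add: spectrum_reflect)
  then have "complex_of_real t - c \<in> \<real>\<^sub>\<ge>\<^sub>0" using a by (auto simp: cstar_positive_def)
  then have "Im c = 0" "Re c \<le> t" by (auto simp: complex_nonneg_Reals_iff)
  moreover have "t - Re c \<le> t"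
    using spectrum_norm_le[OF d] t abs_Re_le_cmod[of "complex_of_real t - c"] by simp
  ultimately show "cmod c \<le> t" by (simp add: cmod_eq_Re)
qed

lemma cstar_positive_add:
  fixes a b :: "'a::cstar_algebra_1"
  assumes a: "a \<in> cstar_positive" and b: "b \<in> cstar_positive"
  shows "a + b \<in> cstar_positive"
proof (rule cstar_positive_if_norm_le)
  show "selfadjoint (a + b)"
    using a b by (simp add: cstar_positive_def selfadjoint_add)
  have "(norm a + norm b) *\<^sub>R 1 - (a + b) = (norm a *\<^sub>R 1 - a) + (norm b *\<^sub>R 1 - b)"
    by (simp add: algebra_simps)
  then show "norm ((norm a + norm b) *\<^sub>R 1 - (a + b)) \<le> norm a + norm b"
    using cstar_positive_norm_diff_le[OF a order_refl] cstar_positive_norm_diff_le[OF b order_refl]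
    by (metis add_mono norm_triangle_le)
qed

lemma cstar_positive_scaleR:
  fixes a :: "'a::cstar_algebra_1"
  assumes a: "a \<in> cstar_positive" and r: "0 \<le> r"
  shows "r *\<^sub>R a \<in> cstar_positive"
proof (rule cstar_positive_if_norm_le)
  show "selfadjoint (r *\<^sub>R a)"
    using a by (simp add: cstar_positive_def selfadjoint_scaleR)
  have "(r * norm a) *\<^sub>R 1 - r *\<^sub>R a = r *\<^sub>R (norm a *\<^sub>R 1 - a)"
    by (simp add: algebra_simps)
  then show "norm ((r * norm a) *\<^sub>R 1 - r *\<^sub>R a) \<le> r * norm a"
    using cstar_positive_norm_diff_le[OF a order_refl] r by (simp add: mult_left_mono)
qed

lemma cstar_le_refl: "selfadjoint a \<Longrightarrow> a \<preceq> a"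
  using cstar_positive_if_norm_le[of 0 0] cstar_scaleR[of 0 a]
  by (simp add: cstar_le_def selfadjoint_def)

lemma cstar_le_trans: "a \<preceq> b \<Longrightarrow> b \<preceq> c \<Longrightarrow> a \<preceq> c"
  using cstar_positive_add[of "b - a" "c - b"] by (simp add: cstar_le_def)

lemma cstar_le_add: "a \<preceq> b \<Longrightarrow> c \<preceq> d \<Longrightarrow> a + c \<preceq> b + d"
  using cstar_positive_add[of "b - a" "d - c"]
  by (simp add: cstar_le_def selfadjoint_add add_diff_add)

lemma cstar_le_scaleR: "a \<preceq> b \<Longrightarrow> 0 \<le> r \<Longrightarrow> r *\<^sub>R a \<preceq> r *\<^sub>R b"
  using cstar_positive_scaleR[of "b - a" r]
  by (simp add: cstar_le_def selfadjoint_scaleR scaleR_diff_right)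

text \<open>The element \<open>t - a\<close> is positive because its distance \<open>\<parallel>a\<parallel>\<close> from \<open>t\<close> is at most \<open>t\<close>.\<close>

lemma cstar_le_norm_bound:
  "selfadjoint a \<Longrightarrow> norm a \<le> t \<Longrightarrow> a \<preceq> t *\<^sub>R 1"
  by (simp add: cstar_le_def selfadjoint_intros cstar_positive_if_norm_le[of _ t])

text \<open>
  From \<open>a \<preceq> b \<preceq> \<parallel>b\<parallel>\<close> the spectrum of \<open>a\<close> lies in the interval from \<open>0\<close> to \<open>\<parallel>b\<parallel>\<close>, so the
  spectral radius bounds the norm of \<open>a\<close>.
\<close>

lemma cstar_norm_mono:
  fixes a b :: "'a::cstar_algebra_1"
  assumes a: "0 \<preceq> a" and ab: "a \<preceq> b"
  shows "norm a \<le> norm b"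
proof (rule selfadjoint_norm_le_spectral_bound)
  show "selfadjoint a" using ab by (simp add: cstar_le_def)
  have "b \<preceq> norm b *\<^sub>R 1"
    using ab by (intro cstar_le_norm_bound) (simp_all add: cstar_le_def)
  with ab have "a \<preceq> norm b *\<^sub>R 1" by (rule cstar_le_trans)
  then have upper: "norm b *\<^sub>R 1 - a \<in> cstar_positive" by (simp add: cstar_le_def)
  fix c assume c: "c \<in> cstar_spectrum a"
  then have "c \<in> \<real>\<^sub>\<ge>\<^sub>0" using a by (auto simp: cstar_le_def cstar_positive_def)
  moreover have "complex_of_real (norm b) - c \<in> cstar_spectrum (norm b *\<^sub>R 1 - a)"
    using c by (simp add: spectrum_reflect)
  then have "complex_of_real (norm b) - c \<in> \<real>\<^sub>\<ge>\<^sub>0"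
    using upper by (auto simp: cstar_positive_def)
  ultimately show "cmod c \<le> norm b"
    by (simp add: complex_nonneg_Reals_iff cmod_eq_Re)
qed simp

section \<open>Partial metrics in norm\<close>

context cstar_partial_metric_space
begin

lemma triangle_le:
  assumes "x \<in> X" "y \<in> X" "z \<in> X"
  shows "p x y \<preceq> p x z + p z y"
proof -
  have "p x z + p z y - p z z \<preceq> p x z + p z y"
    using nonneg[OF assms(1,3)] nonneg[OF assms(3,2)] nonneg[OF assms(3,3)]
    by (simp add: cstar_le_def selfadjoint_intros)
  with triangle[OF assms] show ?thesis by (rule cstar_le_trans)
qed

lemma norm_triangle:
  assumes "x \<in> X" "y \<in> X" "z \<in> X"
  shows "norm (p x y) \<le> norm (p x z) + norm (p z y)"
  using cstar_norm_mono[OF nonneg[OF assms(1,2)] triangle_le[OF assms]]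
    norm_triangle_ineq[of "p x z" "p z y"] by simp

lemma norm_small_self:
  assumes "x \<in> X" "y \<in> X"
  shows "norm (p x x) \<le> norm (p x y)"
  using cstar_norm_mono[OF nonneg[OF assms(1,1)] small_self[OF assms]] .

text \<open>Both self-distances are dominated by \<open>p x y\<close>, so all three values vanish together.\<close>

lemma eq_if_zero_distance:
  assumes "x \<in> X" "y \<in> X" "p x y = 0"
  shows "x = y"
proof -
  have "p x x = 0" "p y y = 0"
    using norm_small_self[of x y] norm_small_self[of y x] sym[of x y] assms by simp_all
  with eq_iff[OF assms(1,2)] assms(3) show ?thesis by simp
qed

text \<open>
  The two self-distances in a gap are dominated by values of \<open>p\<close> with indices beyond the same
  threshold, so the gap has at most twice the size of these; for \<open>g\<close> of norm at most \<open>e\<close>,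
  \<open>\<parallel>g g\<^sup>*\<parallel> \<le> e\<^sup>2\<close> is the order bound that the Cauchy condition asks for.
\<close>

lemma partial_Cauchy_if_norm_small:
  assumes s: "\<And>n. s n \<in> X"
    and small: "\<And>e. 0 < e \<Longrightarrow> \<exists>N. \<forall>n>N. \<forall>m>N. norm (p (s n) (s m)) < e"
  shows "partial_Cauchy p s"
  unfolding partial_Cauchy_def
proof (intro allI impI)
  fix e :: real assume e: "0 < e"
  from small[of "e / 2"] e obtain N where
    N: "\<And>n m. n > N \<Longrightarrow> m > N \<Longrightarrow> norm (p (s n) (s m)) < e / 2" by auto
  have "pm_gap p (s n) (s m) * cstar (pm_gap p (s n) (s m)) \<preceq> e\<^sup>2 *\<^sub>R 1"
    if nm: "n > N" "m > N" for n m
  proof -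
    define g where "g = pm_gap p (s n) (s m)"
    have "norm g \<le> norm (p (s n) (s m) - (1/2) *\<^sub>R p (s n) (s n)) + norm ((1/2) *\<^sub>R p (s m) (s m))"
      unfolding g_def pm_gap_def by (rule norm_triangle_ineq4)
    also have "\<dots> \<le> norm (p (s n) (s m)) + norm ((1/2) *\<^sub>R p (s n) (s n)) +
        norm ((1/2) *\<^sub>R p (s m) (s m))"
      by (intro add_right_mono norm_triangle_ineq4)
    also have "\<dots> < e"
      using N[OF nm] N[OF nm(1,1)] N[OF nm(2,2)] by simp
    finally have g: "norm g \<le> e" by simp
    have "norm (g * cstar g) \<le> norm g * norm (cstar g)" by (rule norm_mult_ineq)
    also have "\<dots> \<le> e * e" unfolding norm_cstar using g by (intro mult_mono) (use e in auto)
    finally have "norm (g * cstar g) \<le> e\<^sup>2" by (simp add: power2_eq_square)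
    then show ?thesis
      unfolding g_def[symmetric] by (intro cstar_le_norm_bound selfadjoint_mult_cstar)
  qed
  then show "\<exists>N. \<forall>n>N. \<forall>m>N.
      pm_gap p (s n) (s m) * cstar (pm_gap p (s n) (s m)) \<preceq> e\<^sup>2 *\<^sub>R 1" by blast
qed

lemma geometric_steps_norm_le:
  assumes s: "\<And>n. s n \<in> X" and h: "0 \<le> h" "h < 1"
    and step: "\<And>n. norm (p (s n) (s (Suc n))) \<le> C * h ^ n"
  shows "norm (p (s n) (s (n + j))) \<le> C * h ^ n / (1 - h)"
proof (induction j arbitrary: n)
  case 0
  have C: "0 \<le> C * h ^ n" using step[of n] norm_ge_zero order_trans by blast
  have "norm (p (s n) (s n)) \<le> C * h ^ n"
    using norm_small_self[OF s s] step[of n] order_trans by blast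
  also have "\<dots> \<le> C * h ^ n / (1 - h)"
    using mult_nonneg_nonneg[OF h(1) C] h by (simp add: field_simps)
  finally show ?case by simp
next
  case (Suc j)
  have "norm (p (s n) (s (n + Suc j))) \<le>
      norm (p (s n) (s (Suc n))) + norm (p (s (Suc n)) (s (Suc n + j)))"
    using norm_triangle[OF s s s, of n "n + Suc j" "Suc n"] by simp
  also have "\<dots> \<le> C * h ^ n + C * h ^ Suc n / (1 - h)"
    using step Suc.IH by (intro add_mono)
  also have "\<dots> = C * h ^ n / (1 - h)"
    using h by (simp add: field_simps)
  finally show ?case .
qed

lemma partial_Cauchy_if_geometric_steps:
  assumes s: "\<And>n. s n \<in> X" and h: "0 \<le> h" "h < 1"
    and step: "\<And>n. norm (p (s n) (s (Suc n))) \<le> C * h ^ n"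
  shows "partial_Cauchy p s"
proof (rule partial_Cauchy_if_norm_small[OF s])
  fix e :: real assume e: "0 < e"
  have "(\<lambda>n. C * h ^ n / (1 - h)) \<longlonglongrightarrow> C * 0 / (1 - h)"
    using h by (intro tendsto_intros LIMSEQ_realpow_zero) auto
  then obtain N where N: "\<And>n. n \<ge> N \<Longrightarrow> C * h ^ n / (1 - h) < e"
    using order_tendstoD(2)[of _ _ sequentially e] e by (fastforce simp: eventually_sequentially)
  have ordered: "norm (p (s n) (s m)) < e" if "n > N" "n \<le> m" for n m
    using geometric_steps_norm_le[OF s h step, of n "m - n"] N[of n] that by simp
  have "norm (p (s n) (s m)) < e" if "n > N" "m > N" for n m
    using ordered[of n m] ordered[of m n] that sym[OF s s, of n m] by (cases "n \<le> m") auto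
  then show "\<exists>N. \<forall>n>N. \<forall>m>N. norm (p (s n) (s m)) < e" by blast
qed

end

text \<open>
  The self-distances of the sequence tend to \<open>0\<close>. Hence its gaps to the limit \<open>x\<close> tend to
  \<open>p x x / 2\<close>, and completeness requires that they tend to \<open>0\<close>.
\<close>

lemma (in complete_cstar_partial_metric_space) limit_of_geometric_steps:
  assumes s: "\<And>n. s n \<in> X" and h: "0 \<le> h" "h < 1"
    and step: "\<And>n. norm (p (s n) (s (Suc n))) \<le> C * h ^ n"
  obtains x where "x \<in> X" "p x x = 0" "(\<lambda>n. p (s n) x) \<longlonglongrightarrow> 0"
proof -
  obtain x where x: "x \<in> X" and conv: "pm_converges p s x"
    and gap: "(\<lambda>n. pm_gap p (s n) x) \<longlonglongrightarrow> 0"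
    using complete[OF s partial_Cauchy_if_geometric_steps[OF s h step]] by blast
  have "(\<lambda>n. C * h ^ n) \<longlonglongrightarrow> C * 0"
    using h by (intro tendsto_intros LIMSEQ_realpow_zero) auto
  then have bound: "(\<lambda>n. C * h ^ n) \<longlonglongrightarrow> 0" by simp
  have "norm (p (s n) (s n)) \<le> C * h ^ n" for n
    using norm_small_self[OF s s] step by (rule order_trans)
  then have self: "(\<lambda>n. p (s n) (s n)) \<longlonglongrightarrow> 0"
    using bound by (rule Lim_null_comparison[OF always_eventually[OF allI]])
  have dist: "(\<lambda>n. p (s n) x - p x x) \<longlonglongrightarrow> 0"
    using conv by (simp add: pm_converges_def)
  have "(\<lambda>n. pm_gap p (s n) x - (p (s n) x - p x x) + (1/2) *\<^sub>R p (s n) (s n))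
      \<longlonglongrightarrow> 0 - 0 + (1/2) *\<^sub>R 0"
    by (intro tendsto_intros gap dist self)
  moreover have "pm_gap p (s n) x - (p (s n) x - p x x) + (1/2) *\<^sub>R p (s n) (s n) =
      (1/2) *\<^sub>R p x x" for n
  proof -
    have "p x x - (1/2) *\<^sub>R p x x = (1/2) *\<^sub>R p x x"
      using scaleR_half_double[of "p x x"] by (simp add: algebra_simps)
    then show ?thesis by (simp add: pm_gap_def)
  qed
  ultimately have "p x x = 0"
    by (simp add: LIMSEQ_const_iff)
  with x dist show ?thesis by (intro that) auto
qed

section \<open>The fixed point\<close>

theorem corollary4p6:
  fixes X :: "'x set"
    and p :: "'x \<Rightarrow> 'x \<Rightarrow> 'a::cstar_algebra_1"
    and T :: "'x \<Rightarrow> 'x"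
    and k :: real
  assumes "complete_cstar_partial_metric_space X p"
    and "\<And>x. x \<in> X \<Longrightarrow> T x \<in> X"
    and "0 < k" and "k < 1/2"
    and "\<And>x y. \<lbrakk>x \<in> X; y \<in> X\<rbrakk> \<Longrightarrow> p (T x) (T y) \<preceq> k *\<^sub>R (p x (T y) + p y (T x))"
  shows "(\<exists>!u. u \<in> X \<and> T u = u) \<and> (\<forall>u\<in>X. T u = u \<longrightarrow> p u u = 0)"
proof -
  interpret complete_cstar_partial_metric_space X p by fact
  note TX = assms(2) and k = assms(3,4) and contr = assms(5)
  have norm_contr: "norm (p (T x) (T y)) \<le> k * (norm (p x (T y)) + norm (p y (T x)))"
    if "x \<in> X" "y \<in> X" for x y
  proof -
    have "norm (p (T x) (T y)) \<le> norm (k *\<^sub>R (p x (T y) + p y (T x)))"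
      using that by (intro cstar_norm_mono nonneg contr TX)
    also have "\<dots> \<le> k * (norm (p x (T y)) + norm (p y (T x)))"
      using k by (simp add: norm_triangle_ineq)
    finally show ?thesis .
  qed
  define h where "h = k / (1 - k)"
  have h: "0 \<le> h" "h < 1" using k by (auto simp: h_def field_simps)
  have step: "norm (p (T x) (T (T x))) \<le> h * norm (p x (T x))" if x: "x \<in> X" for x
  proof -
    \<comment> \<open>The self-distance of \<open>T x\<close> in the contraction condition cancels against the one that the
      triangle inequality subtracts; the cancellation has to happen before norms are taken.\<close>
    have "p x (T (T x)) + p (T x) (T x) \<preceq>
        (p x (T x) + p (T x) (T (T x)) - p (T x) (T x)) + p (T x) (T x)"
      using nonneg[of "T x" "T x"] x TX
      by (intro cstar_le_add triangle cstar_le_refl) (simp_all add: cstar_le_def)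
    then have "k *\<^sub>R (p x (T (T x)) + p (T x) (T x)) \<preceq> k *\<^sub>R (p x (T x) + p (T x) (T (T x)))"
      using k by (intro cstar_le_scaleR) simp_all
    then have "p (T x) (T (T x)) \<preceq> k *\<^sub>R (p x (T x) + p (T x) (T (T x)))"
      using contr[of x "T x"] x TX cstar_le_trans by blast
    then have "norm (p (T x) (T (T x))) \<le> norm (k *\<^sub>R (p x (T x) + p (T x) (T (T x))))"
      using x by (intro cstar_norm_mono nonneg TX)
    also have "\<dots> \<le> k * (norm (p x (T x)) + norm (p (T x) (T (T x))))"
      using k by (simp add: norm_triangle_ineq)
    finally show ?thesis using k by (simp add: h_def field_simps)
  qed
  obtain x0 where x0: "x0 \<in> X" using nonempty by blast
  define s where "s n = (T ^^ n) x0" for n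
  have s: "s n \<in> X" for n by (induction n) (simp_all add: s_def x0 TX)
  have s_Suc: "s (Suc n) = T (s n)" for n by (simp add: s_def)
  have geometric: "norm (p (s n) (s (Suc n))) \<le> norm (p x0 (T x0)) * h ^ n" for n
  proof (induction n)
    case (Suc n)
    have "norm (p (s (Suc n)) (s (Suc (Suc n)))) \<le> h * norm (p (s n) (s (Suc n)))"
      using step[OF s] by (simp add: s_Suc)
    also have "\<dots> \<le> h * (norm (p x0 (T x0)) * h ^ n)"
      using Suc.IH h by (intro mult_left_mono)
    finally show ?case by (simp add: mult_ac)
  qed (simp add: s_def)
  obtain u where u: "u \<in> X" "p u u = 0" and lim: "(\<lambda>n. p (s n) u) \<longlonglongrightarrow> 0"
    using limit_of_geometric_steps[of s, OF s h geometric] by blast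
  have "(1 - k) * norm (p u (T u)) \<le> (1 + k) * norm (p (s (Suc n)) u) + k * norm (p (s n) u)" for n
  proof -
    have "norm (p u (T u)) \<le> norm (p (s (Suc n)) u) + norm (p (s (Suc n)) (T u))"
      using norm_triangle[of u "T u" "s (Suc n)"] sym[of u "s (Suc n)"] u s TX by simp
    moreover have "norm (p (s (Suc n)) (T u)) \<le> k * (norm (p (s n) (T u)) + norm (p (s (Suc n)) u))"
      using norm_contr[of "s n" u] sym[of u "s (Suc n)"] u s TX by (simp add: s_Suc)
    moreover have "k * norm (p (s n) (T u)) \<le> k * (norm (p (s n) u) + norm (p u (T u)))"
      using u s TX k by (intro mult_left_mono norm_triangle) auto
    ultimately show ?thesis by (simp add: algebra_simps)
  qed
  moreover have "(\<lambda>n. (1 + k) * norm (p (s (Suc n)) u) + k * norm (p (s n) u))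
      \<longlonglongrightarrow> (1 + k) * 0 + k * 0"
    by (intro tendsto_intros tendsto_norm_zero lim LIMSEQ_Suc[OF lim])
  ultimately have "(1 - k) * norm (p u (T u)) \<le> (1 + k) * 0 + k * 0"
    by (intro LIMSEQ_le_const) auto
  then have "p u (T u) = 0" using k by (simp add: mult_le_0_iff)
  then have Tu: "T u = u" using eq_if_zero_distance[of u "T u"] u TX by simp
  have zero: "p v w = 0" if "v \<in> X" "w \<in> X" "T v = v" "T w = w" for v w
  proof -
    have "norm (p v w) \<le> k * (2 * norm (p v w))"
      using norm_contr[of v w] sym[of v w] that by simp
    then have "(1 - 2 * k) * norm (p v w) \<le> 0" by (simp add: algebra_simps)
    then show ?thesis using k by (simp add: mult_le_0_iff)
  qed
  show ?thesis
    using u(1) Tu zero eq_if_zero_distance by blast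
qed

end
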